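(* Let $K$ be a real, continuous, isotropic and positive definite kernel on $S^1\times S^1$, and let $a_{k,l}\ge 0$ ($k,l\in\mathbb{Z}_+$) be the coefficients in the series representation $K_r(t,s)=\sum_{k,l=0}^\infty a_{k,l}P_k(t)P_l(s)$, $t,s\in[-1,1]$, of its isotropic part $K_r$. Then $K$ is strictly positive definite if, and only if, the set $\{(k,l)\in\mathbb{Z}^2: a_{|k|,|l|}>0\}$ intersects all the translations of every lattice of $\mathbb{Z}^2$.
   Context: $S^1$ is the unit circle in $\mathbb{R}^2$ with its geodesic distance, and $\cdot$ is the usual inner product of $\mathbb{R}^2$. A real kernel $K$ on $S^1\times S^1$ is a function $K:(S^1\times S^1)\times(S^1\times S^1)\to\mathbb{R}$. It is isotropic if there is a function $K_r:[-1,1]^2\to\mathbb{R}$ (the isotropic part of $K$) with $K((x,z),(y,w))=K_r(x\cdot y,z\cdot w)$ for all $x,y,z,w\in S^1$. A real kernel $K$ on an infinite set $X$ is positive definite if $\sum_{\mu,\nu=1}^n c_\mu c_\nu K(x_\mu,x_\nu)\ge 0$ for every positive integer $n$, all distinct points $x_1,\dots,x_n\in X$ and all real scalars $c_1,\dots,c_n$. It is strictly positive definite if it is positive definite and these inequalities are strict whenever at least one $c_\mu$ is nonzero. Here $X=S^1\times S^1$. $P_k$ is the Tchebyshev polynomial of the first kind of degree $k$, i.e. $P_k(\cos\theta)=\cos k\theta$ (up to a positive normalizing constant, which is irrelevant). It is a known theorem that a real, continuous, isotropic kernel $K$ on $S^1\times S^1$ is positive definite if and only if $K_r(t,s)=\sum_{k,l=0}^\infty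 a_{k,l}P_k(t)P_l(s)$ for $t,s\in[-1,1]$, with all $a_{k,l}\ge 0$ and $\sum_{k,l=0}^\infty a_{k,l}P_k(1)P_l(1)<\infty$. A lattice of $\mathbb{Z}^2$ is a subgroup of the form $(a,b)\mathbb{Z}+(0,d)\mathbb{Z}:=\{(pa,pb+qd):p,q\in\mathbb{Z}\}$ with $a,b,d\in\mathbb{Z}$ and $a,d>0$ (equivalently, a subgroup of rank 2; $\mathbb{Z}^2$ itself is allowed). A translation of a subgroup $S$ of $\mathbb{Z}^2$ is a set $(j,j')+S$ with $(j,j')\in\mathbb{Z}^2$. *)

theory Defs
  imports "HOL-Analysis.Analysis" "HOL-Computational_Algebra.Polynomial"
begin

abbreviation circle :: "(real ^ 2) set" where
  "circle \<equiv> sphere 0 1"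

definition pos_def_kernel_on :: "'a set \<Rightarrow> ('a \<Rightarrow> 'a \<Rightarrow> real) \<Rightarrow> bool" where
  "pos_def_kernel_on X K \<longleftrightarrow>
     (\<forall>n::nat. \<forall>x :: nat \<Rightarrow> 'a. \<forall>c :: nat \<Rightarrow> real.
        n \<ge> 1 \<and> inj_on x {1..n} \<and> x ` {1..n} \<subseteq> X \<longrightarrow>
        (\<Sum>\<mu>=1..n. \<Sum>\<nu>=1..n. c \<mu> * c \<nu> * K (x \<mu>) (x \<nu>)) \<ge> 0)"

definition strictly_pos_def_kernel_on :: "'a set \<Rightarrow> ('a \<Rightarrow> 'a \<Rightarrow> real) \<Rightarrow> bool" where
  "strictly_pos_def_kernel_on X K \<longleftrightarrow>
     pos_def_kernel_on X K \<and>
     (\<forall>n::nat. \<forall>x :: nat \<Rightarrow> 'a. \<forall>c :: nat \<Rightarrow> real.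
        n \<ge> 1 \<and> inj_on x {1..n} \<and> x ` {1..n} \<subseteq> X \<and> (\<exists>\<mu>\<in>{1..n}. c \<mu> \<noteq> 0) \<longrightarrow>
        (\<Sum>\<mu>=1..n. \<Sum>\<nu>=1..n. c \<mu> * c \<nu> * K (x \<mu>) (x \<nu>)) > 0)"

text \<open>
  Continuity refers to the Euclidean topology of the circle, which is also the topology
  of its geodesic distance. Values of \<open>K\<close> off the torus \<open>circle \<times> circle\<close> are irrelevant.
\<close>

definition continuous_torus_kernel ::
    "((real ^ 2) \<times> (real ^ 2) \<Rightarrow> (real ^ 2) \<times> (real ^ 2) \<Rightarrow> real) \<Rightarrow> bool" where
  "continuous_torus_kernel K \<longleftrightarrow>
     continuous_on ((circle \<times> circle) \<times> (circle \<times> circle)) (\<lambda>(u, v). K u v)"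

text \<open>
  \<open>K\<close> is isotropic iff it has an isotropic part. On \<open>[-1,1] \<times> [-1,1]\<close> the isotropic part is
  determined by \<open>K\<close>; elsewhere its values are irrelevant.
\<close>

definition isotropic_part ::
    "((real ^ 2) \<times> (real ^ 2) \<Rightarrow> (real ^ 2) \<times> (real ^ 2) \<Rightarrow> real) \<Rightarrow> (real \<Rightarrow> real \<Rightarrow> real) \<Rightarrow> bool" where
  "isotropic_part K K\<^sub>r \<longleftrightarrow>
     (\<forall>x\<in>circle. \<forall>y\<in>circle. \<forall>z\<in>circle. \<forall>w\<in>circle.
        K (x, z) (y, w) = K\<^sub>r (x \<bullet> y) (z \<bullet> w))"

fun cheb_poly :: "nat \<Rightarrow> real poly" where
  "cheb_poly 0 = 1"
| "cheb_poly (Suc 0) = [:0, 1:]"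
| "cheb_poly (Suc (Suc k)) = [:0, 2:] * cheb_poly (Suc k) - cheb_poly k"

lemma poly_cheb_poly_cos: "poly (cheb_poly k) (cos \<theta>) = cos (real k * \<theta>)"
proof (induction k rule: cheb_poly.induct)
  case (3 k)
  have "cos (real (Suc (Suc k)) * \<theta>) + cos (real k * \<theta>) = 2 * cos \<theta> * cos (real (Suc k) * \<theta>)"
    using cos_add[of "real (Suc k) * \<theta>" \<theta>] cos_diff[of "real (Suc k) * \<theta>" \<theta>]
    by (simp add: algebra_simps)
  then show ?case using 3 by simp
qed simp_all

text \<open>
  The double series is an unordered sum. Its convergence at \<open>t = s = 1\<close> is the condition
  that the sum of all \<open>a k l * P\<^sub>k(1) * P\<^sub>l(1)\<close> be finite.
\<close>

definition cheb_expansion :: "(real \<Rightarrow> real \<Rightarrow> real) \<Rightarrow> (nat \<Rightarrow> nat \<Rightarrow> real) \<Rightarrow> bool" where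
  "cheb_expansion K\<^sub>r a \<longleftrightarrow>
     (\<forall>k l. a k l \<ge> 0) \<and>
     (\<forall>t\<in>{-1..1}. \<forall>s\<in>{-1..1}.
        ((\<lambda>(k, l). a k l * poly (cheb_poly k) t * poly (cheb_poly l) s) has_sum K\<^sub>r t s) UNIV)"

definition is_lattice_Z2 :: "(int \<times> int) set \<Rightarrow> bool" where
  "is_lattice_Z2 L \<longleftrightarrow>
     (\<exists>a b d :: int. a > 0 \<and> d > 0 \<and> L = {(p * a, p * b + q * d) | p q. True})"

definition is_translation_of :: "(int \<times> int) set \<Rightarrow> (int \<times> int) set \<Rightarrow> bool" where
  "is_translation_of T S \<longleftrightarrow> (\<exists>j j' :: int. T = {(j + m, j' + n) | m n. (m, n) \<in> S})"

end

theory Submission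
  imports Defs
begin

text \<open>
  With points \<open>(\<theta>\<^sub>i, \<phi>\<^sub>i)\<close> in angular coordinates and \<open>f(k, l) = \<Sum>\<^sub>i c\<^sub>i exp(\<i>(k \<theta>\<^sub>i + l \<phi>\<^sub>i))\<close>, the quadratic
  form of the kernel is the sum of \<open>a\<^sub>k\<^sub>l (\<bar>f(k, l)\<bar>\<^sup>2 + \<bar>f(k, -l)\<bar>\<^sup>2) / 2\<close>. So strict positive definiteness
  fails iff some nonzero exponential sum \<open>f\<close> vanishes on the index set \<open>{(k, l). a\<^bsub>\<bar>k\<bar>,\<bar>l\<bar>\<^esub> > 0}\<close>.

  If the index set misses a coset of a lattice, it misses a coset \<open>(j, j') + N\<int>\<^sup>2\<close> and, by symmetry,
  also \<open>-(j, j') + N\<int>\<^sup>2\<close>; on \<open>N\<close>-th roots of unity there is a real \<open>f\<close> supported on these two cosets.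

  Conversely, if \<open>f(m) \<noteq> 0\<close>, then \<open>f\<close> has no zero on a whole coset \<open>m + N\<int>\<^sup>2\<close>. The Skolem-Mahler-Lech
  theorem is not needed: in a finitely generated subring of the field \<open>\<complex>\<close> that contains the \<open>c\<^sub>i\<close>,
  the exponentials and their inverses, there is an ideal of finite index modulo which \<open>f(m)\<close> is
  a unit, and modulo which the exponentials have a common finite order \<open>N\<close>.
\<close>

section \<open>Subrings, ideals of finite index and adjunction of an element\<close>

definition subring_of :: "'a::comm_ring_1 set \<Rightarrow> bool" where
  "subring_of R \<longleftrightarrow> 1 \<in> R \<and> (\<forall>x\<in>R. \<forall>y\<in>R. x - y \<in> R \<and> x * y \<in> R)"

definition ideal_of :: "'a::comm_ring_1 set \<Rightarrow> 'a set \<Rightarrow> bool" where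
  "ideal_of R I \<longleftrightarrow> I \<subseteq> R \<and> 0 \<in> I \<and> (\<forall>x\<in>I. \<forall>y\<in>I. x - y \<in> I) \<and> (\<forall>r\<in>R. \<forall>x\<in>I. r * x \<in> I)"

text \<open>\<open>S\<close> is a list of representatives of the residue classes; repetitions and
  elements outside \<open>R\<close> do no harm.\<close>

definition finite_index :: "'a::comm_ring_1 set \<Rightarrow> 'a set \<Rightarrow> bool" where
  "finite_index R I \<longleftrightarrow> (\<exists>S. finite S \<and> (\<forall>x\<in>R. \<exists>s\<in>S. x - s \<in> I))"

text \<open>Applied to an ideal \<open>I\<close>, the same definition gives
  \<open>I[X]\<close>.\<close>

definition polys_over :: "'a::comm_ring_1 set \<Rightarrow> 'a poly set" where
  "polys_over R = {p. \<forall>i. coeff p i \<in> R}"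

definition adjoin :: "'a::comm_ring_1 set \<Rightarrow> 'a \<Rightarrow> 'a set" where
  "adjoin R z = (\<lambda>p. poly p z) ` polys_over R"

text \<open>Asking for a unit in a nonzero finite quotient, and not only for a nonzero residue, lets
  the property pass from \<open>R\<close> to \<open>adjoin R z\<close>: powers of a unit stay
  outside \<open>I\<close>, and a leading coefficient that is a unit can be divided by.\<close>

definition finite_quotients :: "'a::comm_ring_1 set \<Rightarrow> bool" where
  "finite_quotients R \<longleftrightarrow> (\<forall>g\<in>R. g \<noteq> 0 \<longrightarrow>
     (\<exists>I. ideal_of R I \<and> finite_index R I \<and> 1 \<notin> I \<and> (\<exists>h\<in>R. g * h - 1 \<in> I)))"

context
  fixes R :: "'a::comm_ring_1 set"
  assumes R: "subring_of R"
begin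

lemma subring_one: "1 \<in> R"
  and subring_diff: "x \<in> R \<Longrightarrow> y \<in> R \<Longrightarrow> x - y \<in> R"
  and subring_mult: "x \<in> R \<Longrightarrow> y \<in> R \<Longrightarrow> x * y \<in> R"
  using R by (auto simp: subring_of_def)

lemma subring_zero: "0 \<in> R"
  using subring_diff[OF subring_one subring_one] by simp

lemma subring_uminus: "x \<in> R \<Longrightarrow> - x \<in> R"
  using subring_diff[OF subring_zero] by fastforce

lemma subring_add: "x \<in> R \<Longrightarrow> y \<in> R \<Longrightarrow> x + y \<in> R"
  using subring_diff[OF _ subring_uminus, of x y] by simp

lemma subring_power: "x \<in> R \<Longrightarrow> x ^ n \<in> R"
  by (induction n) (auto intro: subring_one subring_mult)

lemma subring_sum: "(\<And>i. i \<in> A \<Longrightarrow> f i \<in> R) \<Longrightarrow> sum f A \<in> R"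
  by (induction A rule: infinite_finite_induct) (auto intro: subring_zero subring_add)

lemmas subring_closed = subring_one subring_zero subring_diff subring_mult subring_uminus
  subring_add subring_power subring_sum

context
  fixes I :: "'a set"
  assumes I: "ideal_of R I"
begin

lemma ideal_subset: "x \<in> I \<Longrightarrow> x \<in> R"
  and ideal_zero: "0 \<in> I"
  and ideal_diff: "x \<in> I \<Longrightarrow> y \<in> I \<Longrightarrow> x - y \<in> I"
  and ideal_mult: "r \<in> R \<Longrightarrow> x \<in> I \<Longrightarrow> r * x \<in> I"
  using I by (auto simp: ideal_of_def)

lemma ideal_mult': "x \<in> I \<Longrightarrow> r \<in> R \<Longrightarrow> x * r \<in> I"
  using ideal_mult by (simp add: mult.commute)

lemma ideal_uminus: "x \<in> I \<Longrightarrow> - x \<in> I"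
  using ideal_diff[OF ideal_zero] by fastforce

lemma ideal_add: "x \<in> I \<Longrightarrow> y \<in> I \<Longrightarrow> x + y \<in> I"
  using ideal_diff[OF _ ideal_uminus, of x y] by simp

lemma ideal_sum: "(\<And>i. i \<in> A \<Longrightarrow> f i \<in> I) \<Longrightarrow> sum f A \<in> I"
  by (induction A rule: infinite_finite_induct) (auto intro: ideal_zero ideal_add)

lemma ideal_power_cong_one:
  assumes "x \<in> R" "x - 1 \<in> I"
  shows "x ^ n - 1 \<in> I"
proof (induction n)
  case (Suc n)
  have "x ^ Suc n - 1 = x * (x ^ n - 1) + (x - 1)"
    by (simp add: algebra_simps)
  moreover have "x * (x ^ n - 1) + (x - 1) \<in> I"
    using Suc assms by (intro ideal_add ideal_mult)
  ultimately show ?case by (metis)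
qed (simp add: ideal_zero)

text \<open>By pigeonhole two powers \<open>u ^ i\<close> and \<open>u ^ j\<close> share a
  representative, and the inverse \<open>v\<close> cancels \<open>u ^ i\<close> from their
  difference.\<close>

lemma finite_unit_order:
  assumes fin: "finite_index R I" and u: "u \<in> R" "v \<in> R" "u * v = 1"
  shows "\<exists>N>0. u ^ N - 1 \<in> I"
proof -
  obtain S where S: "finite S" "\<And>x. x \<in> R \<Longrightarrow> \<exists>s\<in>S. x - s \<in> I"
    using fin by (auto simp: finite_index_def)
  have "\<forall>n. \<exists>s\<in>S. u ^ n - s \<in> I"
    using S(2) u(1) subring_power by blast
  then obtain s where s: "\<And>n. s n \<in> S" "\<And>n. u ^ n - s n \<in> I" by metis
  have "\<not> inj s"
    using s(1) S(1) by (metis finite_subset image_subsetI range_inj_infinite)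
  then obtain i j where ij: "i < j" "s i = s j"
    by (metis injI linorder_neqE_nat)
  have "u ^ j - u ^ i \<in> I"
    using ideal_diff[OF s(2)[of j] s(2)[of i]] ij by simp
  then have "v ^ i * (u ^ j - u ^ i) \<in> I"
    using u by (intro ideal_mult subring_power)
  moreover have "v ^ i * (u ^ j - u ^ i) = u ^ (j - i) - 1"
  proof -
    have "u ^ j = u ^ i * u ^ (j - i)"
      using ij by (simp flip: power_add)
    then have "v ^ i * (u ^ j - u ^ i) = (u * v) ^ i * (u ^ (j - i) - 1)"
      by (simp add: algebra_simps power_mult_distrib)
    then show ?thesis using u by simp
  qed
  ultimately show ?thesis using ij by (intro exI[of _ "j - i"]) auto
qed

text \<open>The product of the exponents that work for single elements works for all of
  them.\<close>

lemma finite_units_common_order: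
  assumes fin: "finite_index R I" and "finite U"
    and "\<And>u. u \<in> U \<Longrightarrow> u \<in> R \<and> (\<exists>v\<in>R. u * v = 1)"
  shows "\<exists>N>0. \<forall>u\<in>U. u ^ N - 1 \<in> I"
  using assms(2,3)
proof (induction U rule: finite_induct)
  case empty
  show ?case by auto
next
  case (insert w U)
  obtain N where N: "N > 0" "\<And>u. u \<in> U \<Longrightarrow> u ^ N - 1 \<in> I"
    using insert.IH[OF insert.prems[OF insertI2]] by metis
  obtain v where wR: "w \<in> R" "v \<in> R" "w * v = 1"
    using insert.prems[of w] by blast
  obtain M where M: "M > 0" "w ^ M - 1 \<in> I"
    using finite_unit_order[OF fin wR] by metis
  have "u ^ (N * M) - 1 \<in> I" if "u \<in> insert w U" for u
  proof (cases "u = w")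
    case True
    have "(w ^ M) ^ N - 1 \<in> I"
      using ideal_power_cong_one[OF subring_power[OF wR(1)] M(2)] .
    then show ?thesis using True by (simp add: mult.commute flip: power_mult)
  next
    case False
    then have "u \<in> R" "u ^ N - 1 \<in> I"
      using insert.prems[OF that] that N(2)[of u] by simp_all
    then have "(u ^ N) ^ M - 1 \<in> I"
      using ideal_power_cong_one[OF subring_power] by blast
    then show ?thesis by (simp flip: power_mult)
  qed
  then show ?case using M N by (intro exI[of _ "N * M"]) auto
qed

lemma polys_over_ideal: "ideal_of (polys_over R) (polys_over I)"
  unfolding ideal_of_def polys_over_def
  by (auto simp: coeff_mult intro: ideal_subset ideal_zero ideal_diff intro!: ideal_sum ideal_mult)

end

lemma polys_over_subring: "subring_of (polys_over R)"
  unfolding subring_of_def polys_over_def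
  by (auto simp: coeff_mult coeff_1 intro!: subring_closed)

lemma const_in_polys_over: "c \<in> R \<Longrightarrow> [:c:] \<in> polys_over R"
  by (auto simp: polys_over_def coeff_pCons split: nat.split intro: subring_zero)

lemma monom_in_polys_over: "c \<in> R \<Longrightarrow> monom c n \<in> polys_over R"
  by (auto simp: polys_over_def intro: subring_zero)

lemma smult_in_polys_over: "c \<in> R \<Longrightarrow> p \<in> polys_over R \<Longrightarrow> smult c p \<in> polys_over R"
  by (auto simp: polys_over_def intro: subring_mult)

lemma adjoin_subring: "subring_of (adjoin R z)"
  unfolding subring_of_def adjoin_def
proof (safe)
  show "1 \<in> (\<lambda>p. poly p z) ` polys_over R"
    by (rule image_eqI[of _ _ 1]) (use polys_over_subring in \<open>auto simp: subring_of_def\<close>)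
next
  fix p q assume "p \<in> polys_over R" "q \<in> polys_over R"
  then have "p - q \<in> polys_over R" "p * q \<in> polys_over R"
    using polys_over_subring by (auto simp: subring_of_def)
  then show "poly p z - poly q z \<in> (\<lambda>p. poly p z) ` polys_over R"
    "poly p z * poly q z \<in> (\<lambda>p. poly p z) ` polys_over R"
    by (metis imageI poly_diff, metis imageI poly_mult)
qed

lemma adjoin_superset: "R \<subseteq> adjoin R z"
proof
  fix x assume "x \<in> R"
  then show "x \<in> adjoin R z"
    unfolding adjoin_def by (intro image_eqI[of _ _ "[:x:]"] const_in_polys_over) auto
qed

lemma adjoin_generator: "z \<in> adjoin R z"
  unfolding adjoin_def
  by (rule image_eqI[of _ _ "monom 1 1"])
    (auto intro: monom_in_polys_over subring_one simp: poly_monom)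

end

section \<open>Pseudo-division and extension of an ideal to \<open>R[z]\<close>\<close>

context
  fixes R :: "'a::comm_ring_1 set"
  assumes R: "subring_of R"
begin

text \<open>Multiplication by the leading coefficient of \<open>q\<close> takes the place of
  division by it whenever a top coefficient is eliminated. The bound on \<open>t\<close> concerns
  coefficients, not the degree, so that it also covers \<open>t = 0\<close> and constant
  \<open>q\<close>.\<close>

lemma pseudo_division:
  assumes q: "q \<in> polys_over R" and p: "p \<in> polys_over R"
  shows "\<exists>k s t. s \<in> polys_over R \<and> t \<in> polys_over R \<and> smult (lead_coeff q ^ k) p = q * s + t
    \<and> (\<forall>i\<ge>degree q. coeff t i = 0)"
proof -
  note Rp = subring_of_def[of "polys_over R", THEN iffD1, OF polys_over_subring[OF R]]
  let ?d = "degree q" and ?a = "lead_coeff q"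
  have a: "?a \<in> R" using q by (auto simp: polys_over_def)
  have zero: "0 \<in> polys_over R" by (auto simp: polys_over_def intro: subring_zero[OF R])
  have add: "x + y \<in> polys_over R" if "x \<in> polys_over R" "y \<in> polys_over R" for x y
    using that by (auto simp: polys_over_def intro: subring_add[OF R])
  have "\<forall>p\<in>polys_over R. (\<forall>i\<ge>m. coeff p i = 0) \<longrightarrow> (\<exists>k s t. s \<in> polys_over R \<and> t \<in> polys_over R
      \<and> smult (?a ^ k) p = q * s + t \<and> (\<forall>i\<ge>?d. coeff t i = 0))" for m
  proof (induction m)
    case 0
    show ?case
    proof (intro ballI impI)
      fix p :: "'a poly" assume p: "p \<in> polys_over R" "\<forall>i\<ge>0. coeff p i = 0"
      show "\<exists>k s t. s \<in> polys_over R \<and> t \<in> polys_over R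
        \<and> smult (?a ^ k) p = q * s + t \<and> (\<forall>i\<ge>?d. coeff t i = 0)"
        by (rule exI[of _ 0], rule exI[of _ 0], rule exI[of _ p]) (use p zero in auto)
    qed
  next
    case (Suc m)
    show ?case
    proof (intro ballI impI)
      fix p assume p: "p \<in> polys_over R" "\<forall>i\<ge>Suc m. coeff p i = 0"
      show "\<exists>k s t. s \<in> polys_over R \<and> t \<in> polys_over R
        \<and> smult (?a ^ k) p = q * s + t \<and> (\<forall>i\<ge>?d. coeff t i = 0)"
      proof (cases "m < ?d")
        case True
        show ?thesis
          by (rule exI[of _ 0], rule exI[of _ 0], rule exI[of _ p]) (use p zero True in auto)
      next
        case False
        let ?M = "monom (coeff p m) (m - ?d)"
        have M: "?M \<in> polys_over R"
          using p by (intro monom_in_polys_over[OF R]) (auto simp: polys_over_def)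
        \<comment> \<open>Both terms have the same coefficient at \<open>m\<close>, so the
          difference satisfies the bound \<open>m\<close> of the induction hypothesis.\<close>
        let ?p = "smult ?a p - ?M * q"
        have p': "?p \<in> polys_over R"
          using Rp M q smult_in_polys_over[OF R a p(1)] by blast
        have "coeff ?p i = 0" if "i \<ge> m" for i
        proof (cases "i = m")
          case True
          then show ?thesis using False by (simp add: coeff_monom_mult)
        next
          case i: False
          then have "coeff q (i - (m - ?d)) = 0"
            using that False by (intro coeff_eq_0) auto
          then show ?thesis using p(2) i that False by (simp add: coeff_monom_mult)
        qed
        with Suc.IH p' obtain k s t where st: "s \<in> polys_over R" "t \<in> polys_over R"
          "smult (?a ^ k) ?p = q * s + t" "\<forall>i\<ge>?d. coeff t i = 0" by blast
        have "smult (?a ^ Suc k) p = q * (s + smult (?a ^ k) ?M) + t"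
          using st(3) by (simp add: algebra_simps smult_diff_right)
        moreover have "s + smult (?a ^ k) ?M \<in> polys_over R"
          using st M a by (intro add smult_in_polys_over[OF R] subring_power[OF R])
        ultimately show ?thesis using st by blast
      qed
    qed
  qed
  then have *: "(\<forall>i\<ge>Suc (degree p). coeff p i = 0) \<longrightarrow> (\<exists>k s t. s \<in> polys_over R \<and> t \<in> polys_over R
      \<and> smult (?a ^ k) p = q * s + t \<and> (\<forall>i\<ge>?d. coeff t i = 0))"
    using p by blast
  show ?thesis by (rule *[rule_format]) (auto intro: coeff_eq_0)
qed

text \<open>A nonconstant polynomial whose leading coefficient is a unit modulo \<open>I\<close> creates no new
  constants in \<open>I[X] + q R[X]\<close>: the top coefficient outside \<open>I\<close> of a cofactor would survive.\<close>

lemma const_in_ideal_plus_multiples: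
  assumes I: "ideal_of R I" and q: "q \<in> polys_over R" "degree q > 0"
    and b: "b \<in> R" "lead_coeff q * b - 1 \<in> I"
    and x: "x \<in> polys_over I" and y: "y \<in> polys_over R" and eq: "[:r:] = x + q * y"
  shows "r \<in> I"
proof -
  let ?d = "degree q"
  have qR: "coeff q i \<in> R" and yR: "coeff y i \<in> R" and xI: "coeff x i \<in> I" for i
    using q x y by (auto simp: polys_over_def)
  have yI: "coeff y i \<in> I" for i
  proof (rule ccontr)
    assume ni: "coeff y i \<notin> I"
    let ?A = "{i. coeff y i \<notin> I}"
    have sub: "?A \<subseteq> {..degree y}"
      using ideal_zero[OF R I] by (auto intro!: le_degree)
    then have fin: "finite ?A" using finite_subset by blast
    define e where "e = Max ?A"
    have e: "coeff y e \<notin> I" "\<And>j. j > e \<Longrightarrow> coeff y j \<in> I"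
      using Max_in[OF fin] Max_ge[OF fin] ni unfolding e_def
      by (blast, meson leD mem_Collect_eq)
    have "coeff (q * y) (?d + e) = (\<Sum>i\<le>?d + e. coeff q i * coeff y (?d + e - i))"
      by (simp add: coeff_mult)
    also have "\<dots> = coeff q ?d * coeff y e
        + (\<Sum>i\<in>{..?d + e} - {?d}. coeff q i * coeff y (?d + e - i))"
      by (subst sum.remove[of _ ?d]) auto
    finally have c: "coeff (q * y) (?d + e) - (\<Sum>i\<in>{..?d + e} - {?d}. coeff q i * coeff y (?d + e - i))
        = coeff q ?d * coeff y e" by simp
    \<comment> \<open>For \<open>i < ?d\<close> the index of the cofactor exceeds \<open>e\<close>;
      for \<open>i > ?d\<close> the coefficient of \<open>q\<close> is zero.\<close>
    have rest: "(\<Sum>i\<in>{..?d + e} - {?d}. coeff q i * coeff y (?d + e - i)) \<in> I"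
    proof (intro ideal_sum[OF R I])
      fix i assume i: "i \<in> {..?d + e} - {?d}"
      show "coeff q i * coeff y (?d + e - i) \<in> I"
      proof (cases "i < ?d")
        case True
        then show ?thesis by (intro ideal_mult[OF R I] qR e(2)) auto
      next
        case False
        then have "coeff q i = 0" using i by (intro coeff_eq_0) auto
        then show ?thesis using ideal_zero[OF R I] by simp
      qed
    qed
    \<comment> \<open>As \<open>?d > 0\<close>, the constant \<open>r\<close> contributes nothing at
      this index.\<close>
    have "coeff [:r:] (?d + e) = 0"
      using q(2) by (auto simp: coeff_pCons split: nat.split)
    then have "coeff (q * y) (?d + e) = - coeff x (?d + e)"
      using eq by (simp add: eq_neg_iff_add_eq_0 add.commute)
    then have "coeff (q * y) (?d + e) \<in> I"
      using ideal_uminus[OF R I xI] by simp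
    then have "coeff q ?d * coeff y e \<in> I"
      using ideal_diff[OF R I _ rest] c by metis
    \<comment> \<open>The left side equals \<open>coeff y e\<close>: \<open>b\<close> inverts the
      leading coefficient modulo \<open>I\<close>.\<close>
    then have "b * (coeff q ?d * coeff y e) - (coeff q ?d * b - 1) * coeff y e \<in> I"
      using ideal_diff[OF R I ideal_mult[OF R I b(1)] ideal_mult'[OF R I b(2) yR]] by blast
    then show False using e(1) by (simp add: algebra_simps)
  qed
  have "r = coeff x 0 + coeff q 0 * coeff y 0"
    using arg_cong[OF eq, of "\<lambda>p. coeff p 0"] by (simp add: coeff_mult)
  then show ?thesis
    using xI yI qR by (metis ideal_add[OF R I] ideal_mult[OF R I])
qed

text \<open>The image of \<open>I[X] + q R[X]\<close> under evaluation at \<open>z\<close>: the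
  ideal of \<open>R[z]\<close> generated by \<open>I\<close> and \<open>q(z)\<close>. If
  \<open>q(z) = 0\<close>, it is the extension of \<open>I\<close> alone.\<close>

definition extended_ideal :: "'a set \<Rightarrow> 'a poly \<Rightarrow> 'a \<Rightarrow> 'a set" where
  "extended_ideal I q z = {poly (x + q * y) z |x y. x \<in> polys_over I \<and> y \<in> polys_over R}"

context
  fixes I :: "'a set" and q :: "'a poly" and z b :: 'a
  assumes I: "ideal_of R I" and q: "q \<in> polys_over R"
    and b: "b \<in> R" "lead_coeff q * b - 1 \<in> I"
begin

lemma extended_ideal_ideal: "ideal_of (adjoin R z) (extended_ideal I q z)"
proof -
  note Ip = polys_over_ideal[OF R I] and Rp = polys_over_subring[OF R]
  have "poly (x + q * y) z \<in> adjoin R z" if "x \<in> polys_over I" "y \<in> polys_over R" for x y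
    unfolding adjoin_def
    by (intro imageI subring_add[OF Rp] subring_mult[OF Rp] q that ideal_subset[OF Rp Ip])
  then have 1: "extended_ideal I q z \<subseteq> adjoin R z"
    by (auto simp: extended_ideal_def)
  have "0 = poly (0 + q * 0) z" by simp
  then have 2: "0 \<in> extended_ideal I q z"
    using ideal_zero[OF Rp Ip] subring_zero[OF Rp] unfolding extended_ideal_def by blast
  have 3: "u - v \<in> extended_ideal I q z"
    if uv: "u \<in> extended_ideal I q z" "v \<in> extended_ideal I q z" for u v
  proof -
    obtain x y x' y' where *: "x \<in> polys_over I" "y \<in> polys_over R" "x' \<in> polys_over I"
      "y' \<in> polys_over R" "u = poly (x + q * y) z" "v = poly (x' + q * y') z"
      using uv unfolding extended_ideal_def by blast
    then have "u - v = poly ((x - x') + q * (y - y')) z" by (simp add: algebra_simps)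
    moreover have "x - x' \<in> polys_over I" "y - y' \<in> polys_over R"
      using * ideal_diff[OF Rp Ip] subring_diff[OF Rp] by auto
    ultimately show ?thesis unfolding extended_ideal_def by blast
  qed
  have 4: "r * u \<in> extended_ideal I q z" if ru: "r \<in> adjoin R z" "u \<in> extended_ideal I q z" for r u
  proof -
    obtain x y p where *: "x \<in> polys_over I" "y \<in> polys_over R" "p \<in> polys_over R"
      "u = poly (x + q * y) z" "r = poly p z"
      using ru unfolding extended_ideal_def adjoin_def by blast
    then have "r * u = poly (p * x + q * (p * y)) z" by (simp add: algebra_simps)
    moreover have "p * x \<in> polys_over I" "p * y \<in> polys_over R"
      using * ideal_mult[OF Rp Ip] subring_mult[OF Rp] by auto
    ultimately show ?thesis unfolding extended_ideal_def by blast
  qed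
  show ?thesis using 1 2 3 4 by (auto simp: ideal_of_def)
qed

lemma extended_ideal_superset: "x \<in> I \<Longrightarrow> x \<in> extended_ideal I q z"
proof -
  assume "x \<in> I"
  then have "[:x:] \<in> polys_over I" "(0::'a poly) \<in> polys_over R"
    using ideal_zero[OF R I] subring_zero[OF R]
    by (auto simp: polys_over_def coeff_pCons split: nat.split)
  moreover have "x = poly ([:x:] + q * 0) z" by simp
  ultimately show ?thesis unfolding extended_ideal_def by blast
qed

text \<open>Since the leading coefficient of \<open>q\<close> is a unit modulo \<open>I\<close>,
  every polynomial is congruent modulo \<open>I[X] + q R[X]\<close> to one with fewer than
  \<open>degree q + 1\<close> coefficients, and these can be moved into the finite set of
  representatives.\<close>

lemma extended_ideal_finite_index:
  assumes fin: "finite_index R I"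
  shows "finite_index (adjoin R z) (extended_ideal I q z)"
proof -
  note Ip = polys_over_ideal[OF R I] and Rp = polys_over_subring[OF R]
  let ?a = "lead_coeff q" and ?d = "degree q"
  have a: "?a \<in> R" using q by (auto simp: polys_over_def)
  obtain S where S: "finite S" "\<And>x. x \<in> R \<Longrightarrow> \<exists>s\<in>S. x - s \<in> I"
    using fin by (auto simp: finite_index_def)
  define T where "T = (\<lambda>f. poly (\<Sum>i<?d. monom (f i) i) z) ` (PiE {..<?d} (\<lambda>_. S))"
  have "finite T" unfolding T_def using S(1) by (intro finite_imageI finite_PiE) auto
  moreover have "\<exists>w\<in>T. u - w \<in> extended_ideal I q z" if u: "u \<in> adjoin R z" for u
  proof -
    obtain p where p: "p \<in> polys_over R" "u = poly p z" using u by (auto simp: adjoin_def)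
    obtain k s t where st: "s \<in> polys_over R" "t \<in> polys_over R" "smult (?a ^ k) p = q * s + t"
      "\<forall>i\<ge>?d. coeff t i = 0"
      using pseudo_division[OF q p(1)] by blast
    let ?t = "smult (b ^ k) t"
    have tR: "coeff ?t i \<in> R" for i
      using st(2) b(1) by (auto simp: polys_over_def intro!: subring_mult[OF R] subring_power[OF R])
    obtain f where f: "\<And>i. f i \<in> S" "\<And>i. coeff ?t i - f i \<in> I"
      using S(2)[OF tR] by metis
    let ?f = "restrict f {..<?d}"
    let ?w = "\<Sum>i<?d. monom (?f i) i"
    have cw: "coeff ?w i = (if i < ?d then f i else 0)" for i
      unfolding coeff_sum coeff_monom by (subst sum.delta) auto
    have "coeff (?t - ?w) i \<in> I" for i
      using f(2)[of i] st(4) ideal_zero[OF R I] unfolding coeff_diff cw by auto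
    then have x1: "?t - ?w \<in> polys_over I" by (auto simp: polys_over_def)
    have "(?a * b) ^ k - 1 \<in> I"
      using a b by (intro ideal_power_cong_one[OF R I] subring_mult[OF R])
    then have "1 - (?a * b) ^ k \<in> I"
      using ideal_uminus[OF R I] by fastforce
    then have x2: "smult (1 - (?a * b) ^ k) p \<in> polys_over I"
      using p(1) by (auto simp: polys_over_def intro: ideal_mult'[OF R I])
    have "smult (b ^ k) (smult (?a ^ k) p) = q * smult (b ^ k) s + ?t"
      using st(3) by (simp add: smult_add_right)
    \<comment> \<open>The first two summands lie in \<open>I[X]\<close>: \<open>(?a * b) ^ k\<close>
      is congruent to 1, and the coefficients of \<open>?w\<close> represent those of
      \<open>?t\<close>.\<close>
    then have "p - ?w = (smult (1 - (?a * b) ^ k) p + (?t - ?w)) + q * smult (b ^ k) s"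
      by (simp add: smult_diff_left power_mult_distrib algebra_simps)
    moreover have "smult (1 - (?a * b) ^ k) p + (?t - ?w) \<in> polys_over I"
      using ideal_add[OF Rp Ip x2 x1] .
    moreover have "smult (b ^ k) s \<in> polys_over R"
      using b st by (intro smult_in_polys_over[OF R] subring_power[OF R])
    ultimately have "poly (p - ?w) z \<in> extended_ideal I q z"
      unfolding extended_ideal_def by (metis (mono_tags, lifting) mem_Collect_eq)
    moreover have "poly ?w z \<in> T"
      unfolding T_def using f(1) by (intro imageI restrict_PiE_iff[THEN iffD2]) auto
    ultimately show ?thesis using p(2) by (metis poly_diff)
  qed
  ultimately show ?thesis unfolding finite_index_def by blast
qed

end

end

section \<open>Finite quotients of the integers and of finitely generated subrings of a
  field\<close>

lemma finite_quotients_Ints: "finite_quotients (\<int> :: 'a::field_char_0 set)"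
  unfolding finite_quotients_def
proof (intro ballI impI)
  fix g :: 'a assume "g \<in> \<int>" "g \<noteq> 0"
  then obtain m :: int where m: "g = of_int m" "m \<noteq> 0" by (auto simp: Ints_def)
  \<comment> \<open>With this modulus \<open>m * (- 2 * sgn m) = 1 - p\<close>, so
    \<open>- 2 * sgn m\<close> is an explicit inverse of \<open>m\<close>.\<close>
  define p where "p = 2 * \<bar>m\<bar> + 1"
  have p: "p > 1" using m by (simp add: p_def)
  let ?I = "range (\<lambda>k. of_int (p * k) :: 'a)"
  have "ideal_of \<int> ?I"
    unfolding ideal_of_def
  proof (intro conjI ballI)
    show "0 \<in> ?I" by (rule image_eqI[of _ _ 0]) auto
  next
    fix x y assume "x \<in> ?I" "y \<in> ?I"
    then obtain i j where "x = of_int (p * i)" "y = of_int (p * j)" by auto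
    then show "x - y \<in> ?I" by (intro image_eqI[of _ _ "i - j"]) (auto simp: algebra_simps)
  next
    fix r x :: 'a assume "r \<in> \<int>" "x \<in> ?I"
    then obtain i j where "r = of_int i" "x = of_int (p * j)" by (auto simp: Ints_def)
    then show "r * x \<in> ?I" by (intro image_eqI[of _ _ "i * j"]) (auto simp: algebra_simps)
  qed auto
  moreover have "finite_index \<int> ?I"
    unfolding finite_index_def
  proof (intro exI conjI ballI)
    show "finite (of_int ` {0..<p} :: 'a set)" by simp
    fix x :: 'a assume "x \<in> \<int>"
    then obtain i where i: "x = of_int i" by (auto simp: Ints_def)
    have "x - of_int (i mod p) = of_int (p * (i div p))"
      unfolding i of_int_diff[symmetric] by (simp add: minus_mod_eq_mult_div)
    moreover have "of_int (i mod p) \<in> (of_int ` {0..<p} :: 'a set)" using p by simp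
    ultimately show "\<exists>s\<in>of_int ` {0..<p}. x - s \<in> ?I" by blast
  qed
  moreover have "1 \<notin> ?I"
  proof
    assume "1 \<in> ?I"
    then obtain k where "(of_int 1 :: 'a) = of_int (p * k)" by auto
    then have "1 = p * k" using of_int_eq_iff by blast
    then show False using p by (metis less_irrefl one_less_mult pos_zmult_eq_1_iff zero_less_one_class.zero_less_one order.strict_trans)
  qed
  moreover have "g * of_int (- 2 * sgn m) - 1 \<in> ?I"
  proof (rule image_eqI[of _ _ "-1"])
    have "m * (- 2 * sgn m) - 1 = p * (-1)"
      by (simp add: p_def mult.commute mult.left_commute abs_mult_sgn)
        (simp add: abs_sgn algebra_simps)
    then have "of_int (m * (- 2 * sgn m) - 1) = (of_int (p * (-1)) :: 'a)" by metis
    then show "g * of_int (- 2 * sgn m) - 1 = of_int (p * (-1))"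
      unfolding m(1) by (simp only: of_int_mult of_int_diff of_int_1)
  qed simp
  ultimately show "\<exists>I. ideal_of \<int> I \<and> finite_index \<int> I \<and> 1 \<notin> I \<and> (\<exists>h\<in>\<int>. g * h - 1 \<in> I)"
    by (intro exI[of _ ?I] conjI bexI[of _ "of_int (- 2 * sgn m)"]) auto
qed

text \<open>Take a nonzero multiple of \<open>g\<close> of least degree as a polynomial in \<open>z\<close>. Were the degree
  positive, pseudo-division of the minimal relation \<open>q\<close> by it would give a shorter relation.\<close>

lemma multiple_in_base_ring:
  fixes R :: "'a::field set"
  assumes R: "subring_of R" and q: "q \<in> polys_over R" "q \<noteq> 0" "poly q z = 0"
    and min: "\<And>s. s \<in> polys_over R \<Longrightarrow> poly s z = 0 \<Longrightarrow> \<forall>i\<ge>degree q. coeff s i = 0 \<Longrightarrow> s = 0"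
    and g: "g \<in> adjoin R z" "g \<noteq> 0"
  shows "\<exists>h\<in>adjoin R z. g * h \<in> R \<and> g * h \<noteq> 0"
proof -
  note Rp = polys_over_subring[OF R] and Ra = adjoin_subring[OF R]
  have ev: "poly p z \<in> adjoin R z" if "p \<in> polys_over R" for p
    using that by (auto simp: adjoin_def)
  have cR: "coeff p i \<in> R" if "p \<in> polys_over R" for p i
    using that by (auto simp: polys_over_def)
  \<comment> \<open>Here \<open>e\<close> is a strict bound for the degree of a representative
    \<open>t\<close> of a nonzero multiple of \<open>g\<close>; a multiple in \<open>R\<close> is
    the case \<open>e = 1\<close>.\<close>
  define P where "P e \<longleftrightarrow> (\<exists>t\<in>polys_over R. (\<forall>i\<ge>e. coeff t i = 0) \<and> poly t z \<noteq> 0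
    \<and> (\<exists>h\<in>adjoin R z. poly t z = g * h))" for e
  \<comment> \<open>Pseudo-division by the relation \<open>q\<close> only scales the value at
    \<open>z\<close> by a nonzero power of \<open>lead_coeff q\<close>, so larger bounds can be
    lowered to \<open>degree q\<close>.\<close>
  have P_red: "P (min e (degree q))" if e: "P e" for e
  proof (cases "e \<le> degree q")
    case False
    obtain t h where t: "t \<in> polys_over R" "poly t z \<noteq> 0" "h \<in> adjoin R z" "poly t z = g * h"
      using e unfolding P_def by blast
    obtain k s w where w: "w \<in> polys_over R" "smult (lead_coeff q ^ k) t = q * s + w"
      "\<forall>i\<ge>degree q. coeff w i = 0"
      using pseudo_division[OF R q(1) t(1)] by blast
    have "poly w z = lead_coeff q ^ k * poly t z"
      using arg_cong[OF w(2), of "\<lambda>p. poly p z"] q(3) by simp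
    moreover from this have "poly w z = g * (lead_coeff q ^ k * h)" using t by simp
    moreover have "lead_coeff q ^ k * h \<in> adjoin R z"
      using adjoin_superset[OF R] t cR[OF q(1)]
      by (intro subring_mult[OF Ra] subring_power[OF Ra]) auto
    ultimately have "P (degree q)"
      unfolding P_def using w t q(2) by (intro bexI[of _ w]) auto
    then show ?thesis using False by (simp add: min_def)
  qed (use e in \<open>simp add: min_def\<close>)
  obtain p where p: "p \<in> polys_over R" "g = poly p z" using g by (auto simp: adjoin_def)
  have "P (Suc (degree p))"
    unfolding P_def using p g subring_one[OF Ra]
    by (intro bexI[of _ p]) (auto intro: coeff_eq_0 bexI[of _ 1])
  define e where "e = (LEAST e. P e)"
  have Pe: "P e" using \<open>P (Suc (degree p))\<close> unfolding e_def by (rule LeastI)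
  have least: "\<not> P i" if "i < e" for i using that not_less_Least unfolding e_def by blast
  have ed: "e \<le> degree q" using P_red[OF Pe] least[of "min e (degree q)"] by linarith
  obtain t h where t: "t \<in> polys_over R" "\<forall>i\<ge>e. coeff t i = 0" "poly t z \<noteq> 0"
    "h \<in> adjoin R z" "poly t z = g * h"
    using Pe unfolding P_def by blast
  have t0: "t \<noteq> 0" using t(3) by auto
  then have dt: "degree t < e" using t(2) by (metis leI leading_coeff_0_iff)
  have "degree t = 0"
  proof (rule ccontr)
    assume dpos: "degree t \<noteq> 0"
    obtain k s w where w: "s \<in> polys_over R" "w \<in> polys_over R"
      "smult (lead_coeff t ^ k) q = t * s + w" "\<forall>i\<ge>degree t. coeff w i = 0"
      using pseudo_division[OF R t(1) q(1)] by blast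
    have "poly w z = - (poly t z * poly s z)"
      using arg_cong[OF w(3), of "\<lambda>p. poly p z"] q(3) by (simp add: eq_neg_iff_add_eq_0 add.commute)
    then have wz: "poly w z = g * (- (h * poly s z))" using t(5) by simp
    have "- (h * poly s z) \<in> adjoin R z"
      using t ev w by (intro subring_uminus[OF Ra] subring_mult[OF Ra])
    \<comment> \<open>A nonzero value would be a multiple of \<open>g\<close> with the smaller bound
      \<open>degree t\<close>.\<close>
    then have "poly w z = 0"
      using least[OF dt] wz w unfolding P_def by blast
    \<comment> \<open>So the quotient \<open>s\<close> is a relation for \<open>z\<close>.
      Comparison of coefficients with \<open>q\<close> shows that it is nonzero and of smaller
      degree than \<open>q\<close>, against minimality.\<close>
    then have sz: "poly s z = 0"
      using \<open>poly w z = - (poly t z * poly s z)\<close> t(3) by simp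
    have "degree w < degree q \<or> w = 0"
      using w(4) ed dt by (metis le_eq_less_or_eq leading_coeff_0_iff linorder_not_less order.strict_trans1)
    then have "coeff w (degree q) = 0" by (auto intro: coeff_eq_0)
    then have "coeff (t * s) (degree q) = lead_coeff t ^ k * lead_coeff q"
      using arg_cong[OF w(3), of "\<lambda>p. coeff p (degree q)"] by simp
    then have s0: "s \<noteq> 0" using t0 q(2) by auto
    have "coeff (t * s) i = 0" if "i > degree q" for i
    proof -
      have "coeff w i = 0" using w(4) that ed dt by auto
      moreover have "coeff q i = 0" using that by (intro coeff_eq_0)
      ultimately show ?thesis using arg_cong[OF w(3), of "\<lambda>p. coeff p i"] by simp
    qed
    then have "degree (t * s) \<le> degree q" by (intro degree_le) auto
    then have "degree s < degree q" using degree_mult_eq[OF t0 s0] dpos by linarith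
    then have "s = 0" by (intro min w sz) (auto intro: coeff_eq_0)
    with s0 show False by simp
  qed
  then obtain r where r: "t = [:r:]" by (metis degree_eq_zeroE)
  then have "r \<in> R" using cR[OF t(1), of 0] by simp
  then show ?thesis using t r by (intro bexI[of _ h]) auto
qed

text \<open>If \<open>z\<close> is algebraic over \<open>R\<close>, then \<open>g\<close> has a
  nonzero multiple in \<open>R\<close>. An ideal of \<open>R\<close> modulo which this multiple and
  the leading coefficient of a minimal relation are units is extended to \<open>R[z]\<close>. If
  \<open>z\<close> is transcendental, a relation is imposed that makes \<open>g\<close> a
  unit.\<close>

lemma finite_quotients_adjoin:
  fixes R :: "'a::field set"
  assumes R: "subring_of R" and fq: "finite_quotients R"
  shows "finite_quotients (adjoin R z)"
  unfolding finite_quotients_def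
proof (intro ballI impI)
  fix g assume g: "g \<in> adjoin R z" "g \<noteq> 0"
  note Rp = polys_over_subring[OF R] and Ra = adjoin_subring[OF R]
  show "\<exists>J. ideal_of (adjoin R z) J \<and> finite_index (adjoin R z) J \<and> 1 \<notin> J
      \<and> (\<exists>h\<in>adjoin R z. g * h - 1 \<in> J)"
  proof (cases "\<exists>q\<in>polys_over R. q \<noteq> 0 \<and> poly q z = 0")
    case True
    then obtain q where q: "q \<in> polys_over R" "q \<noteq> 0" "poly q z = 0"
      and minq: "\<And>s. s \<in> polys_over R \<Longrightarrow> s \<noteq> 0 \<Longrightarrow> poly s z = 0 \<Longrightarrow> degree q \<le> degree s"
      using ex_has_least_nat[of "\<lambda>q. q \<in> polys_over R \<and> q \<noteq> 0 \<and> poly q z = 0" _ degree] by metis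
    have min: "s = 0" if "s \<in> polys_over R" "poly s z = 0" "\<forall>i\<ge>degree q. coeff s i = 0" for s
      using minq[OF that(1) _ that(2)] that(3) leading_coeff_0_iff by blast
    have dq: "degree q > 0"
      using q by (auto elim!: degree_eq_zeroE intro!: gr0I)
    obtain h where h: "h \<in> adjoin R z" "g * h \<in> R" "g * h \<noteq> 0"
      using multiple_in_base_ring[OF R q min g] by blast
    let ?a = "lead_coeff q" and ?r = "g * h"
    have a: "?a \<in> R" using q by (auto simp: polys_over_def)
    have "?a * ?r \<in> R" "?a * ?r \<noteq> 0" using a h q by (auto intro: subring_mult[OF R])
    then obtain I b where I: "ideal_of R I" "finite_index R I" "1 \<notin> I" and b: "b \<in> R"
      "?a * ?r * b - 1 \<in> I"
      using fq unfolding finite_quotients_def by blast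
    \<comment> \<open>If the product \<open>?a * ?r\<close> is a unit, so are its factors:
      \<open>?r * b\<close> inverts \<open>?a\<close>, and \<open>?a * b\<close> inverts
      \<open>?r\<close>.\<close>
    have rb: "?r * b \<in> R" "?a * (?r * b) - 1 \<in> I"
      using b h using subring_mult[OF R h(2) b(1)] b(2) by (simp_all only: mult.assoc)
    let ?J = "extended_ideal R I q z"
    have "1 \<notin> ?J"
    proof
      assume "1 \<in> ?J"
      then obtain x y where xy: "x \<in> polys_over I" "y \<in> polys_over R" "1 = poly (x + q * y) z"
        by (auto simp: extended_ideal_def[OF R])
      \<comment> \<open>\<open>?p\<close> vanishes at \<open>z\<close>, so by minimality of
        \<open>q\<close> its pseudo-remainder is zero. This puts a power of \<open>?a\<close> into
        \<open>I[X] + q R[X]\<close>, hence into \<open>I\<close>, although \<open>?a\<close> is a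
        unit modulo \<open>I\<close>.\<close>
      let ?p = "1 - (x + q * y)"
      have "?p \<in> polys_over R"
        using xy ideal_subset[OF Rp polys_over_ideal[OF R I(1)]] q
        by (intro subring_diff[OF Rp] subring_one[OF Rp] subring_add[OF Rp] subring_mult[OF Rp]) auto
      then obtain k s t where st: "s \<in> polys_over R" "t \<in> polys_over R"
        "smult (?a ^ k) ?p = q * s + t" "\<forall>i\<ge>degree q. coeff t i = 0"
        using pseudo_division[OF R q(1)] by blast
      have "poly t z = 0"
        using arg_cong[OF st(3), of "\<lambda>p. poly p z"] q(3) xy(3) by simp
      then have "t = 0" using min st by blast
      then have "[:?a ^ k:] = smult (?a ^ k) x + q * (smult (?a ^ k) y + s)"
        using st(3) by (simp add: algebra_simps smult_diff_right smult_add_right flip: smult_one)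
      moreover have "smult (?a ^ k) x \<in> polys_over I"
        using xy a by (auto simp: polys_over_def intro!: ideal_mult[OF R I(1)] subring_power[OF R])
      moreover have "smult (?a ^ k) y + s \<in> polys_over R"
        using xy st a by (intro subring_add[OF Rp] smult_in_polys_over[OF R] subring_power[OF R])
      ultimately have "?a ^ k \<in> I"
        using const_in_ideal_plus_multiples[OF R I(1) q(1) dq rb] by blast
      then have "?a ^ k * (?r * b) ^ k \<in> I"
        using rb by (intro ideal_mult'[OF R I(1)] subring_power[OF R])
      moreover have "(?a * (?r * b)) ^ k - 1 \<in> I"
        using ideal_power_cong_one[OF R I(1) subring_mult[OF R a rb(1)] rb(2)] .
      ultimately have "?a ^ k * (?r * b) ^ k - ((?a * (?r * b)) ^ k - 1) \<in> I"
        using ideal_diff[OF R I(1)] by blast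
      then show False using I(3) by (simp add: power_mult_distrib)
    qed
    moreover have "g * (h * (?a * b)) - 1 \<in> ?J"
      using extended_ideal_superset[OF R I(1) q(1) rb b(2)] by (simp add: mult_ac)
    moreover have "h * (?a * b) \<in> adjoin R z"
      using adjoin_superset[OF R, of z] h a b by (intro subring_mult[OF Ra]) auto
    ultimately show ?thesis
      using extended_ideal_ideal[OF R I(1) q(1) rb] extended_ideal_finite_index[OF R I(1) q(1) rb I(2)]
      by blast
  next
    case False
    obtain p where p: "p \<in> polys_over R" "g = poly p z" using g by (auto simp: adjoin_def)
    have p0: "p \<noteq> 0" using p g by auto
    \<comment> \<open>This is \<open>1 + X p(X)\<close>, so killing its value at \<open>z\<close>
      makes \<open>- z\<close> an inverse of \<open>g\<close>.\<close>
    let ?q = "pCons 1 p"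
    have q: "?q \<in> polys_over R"
      using p subring_one[OF R] by (auto simp: polys_over_def coeff_pCons split: nat.split)
    have dq: "degree ?q > 0" using p0 by simp
    have lq: "lead_coeff ?q = lead_coeff p" using p0 by simp
    have "lead_coeff p \<in> R" "lead_coeff p \<noteq> 0" using p p0 by (auto simp: polys_over_def)
    then obtain I b where I: "ideal_of R I" "finite_index R I" "1 \<notin> I" and b: "b \<in> R"
      "lead_coeff ?q * b - 1 \<in> I"
      using fq unfolding finite_quotients_def lq by blast
    let ?J = "extended_ideal R I ?q z"
    have "1 \<notin> ?J"
    proof
      assume "1 \<in> ?J"
      then obtain x y where xy: "x \<in> polys_over I" "y \<in> polys_over R" "1 = poly (x + ?q * y) z"
        by (auto simp: extended_ideal_def[OF R])
      let ?p = "1 - (x + ?q * y)"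
      have "?p \<in> polys_over R"
        using xy ideal_subset[OF Rp polys_over_ideal[OF R I(1)]] q
        by (intro subring_diff[OF Rp] subring_one[OF Rp] subring_add[OF Rp] subring_mult[OF Rp]) auto
      moreover have "poly ?p z = 0" using xy(3) by simp
      \<comment> \<open>As \<open>z\<close> satisfies no relation, the identity at \<open>z\<close>
        is one of polynomials.\<close>
      ultimately have "?p = 0" using False by blast
      then have "[:1:] = x + ?q * y" by (simp add: one_pCons)
      then show False
        using const_in_ideal_plus_multiples[OF R I(1) q dq b xy(1,2)] I(3) by blast
    qed
    moreover have "g * (- z) - 1 \<in> ?J"
    proof -
      have "g * (- z) - 1 = poly (0 + ?q * (-1)) z" using p by (simp add: algebra_simps)
      moreover have "0 \<in> polys_over I" "-1 \<in> polys_over R"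
        using ideal_zero[OF R I(1)] subring_uminus[OF Rp subring_one[OF Rp]]
        by (auto simp: polys_over_def)
      ultimately show ?thesis unfolding extended_ideal_def[OF R] by blast
    qed
    moreover have "- z \<in> adjoin R z"
      using adjoin_generator[OF R] by (intro subring_uminus[OF Ra])
    ultimately show ?thesis
      using extended_ideal_ideal[OF R I(1) q b] extended_ideal_finite_index[OF R I(1) q b I(2)]
      by blast
  qed
qed

lemma subring_finite_quotients_containing:
  fixes Z :: "'a::field_char_0 set"
  assumes "finite Z"
  shows "\<exists>R. subring_of R \<and> finite_quotients R \<and> Z \<subseteq> R"
  using assms
proof (induction Z rule: finite_induct)
  case empty
  have "subring_of (\<int> :: 'a set)" by (auto simp: subring_of_def)
  then show ?case using finite_quotients_Ints by blast
next
  case (insert z Z)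
  then obtain R where R: "subring_of R" "finite_quotients R" "Z \<subseteq> R" by blast
  then show ?case
    using adjoin_subring[OF R(1)] finite_quotients_adjoin[OF R(1,2)]
      adjoin_superset[OF R(1), of z] adjoin_generator[OF R(1), of z] by blast
qed

section \<open>Exponential sums over a field\<close>

lemma exponential_sum_nonvanishing_coset:
  fixes u v c :: "'i \<Rightarrow> 'a::field_char_0"
  assumes S: "finite S" and nz: "\<And>i. i \<in> S \<Longrightarrow> u i \<noteq> 0 \<and> v i \<noteq> 0"
    and E: "(\<Sum>i\<in>S. c i * u i powi k * v i powi l) \<noteq> 0"
  shows "\<exists>N::nat. N > 0 \<and>
    (\<forall>p q. (\<Sum>i\<in>S. c i * u i powi (k + int N * p) * v i powi (l + int N * q)) \<noteq> 0)"
proof -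
  \<comment> \<open>Inverses are included so that negative powers also lie in the ring.\<close>
  define U where "U = u ` S \<union> v ` S \<union> inverse ` (u ` S \<union> v ` S)"
  have U: "x \<noteq> 0" "inverse x \<in> U" if "x \<in> U" for x
    using that nz by (auto simp: U_def)
  have finU: "finite U" using S by (simp add: U_def)
  obtain R where R: "subring_of R" "finite_quotients R" "U \<union> c ` S \<subseteq> R"
    using subring_finite_quotients_containing[of "U \<union> c ` S"] finU S by auto
  have UR: "x \<in> R" if "x \<in> U" for x using R(3) that by blast
  have powi_R: "x powi n \<in> R" if "x \<in> U" for x n
    unfolding power_int_def using that U UR by (auto intro!: subring_power[OF R(1)])
  have uv: "u i \<in> U" "v i \<in> U" "c i \<in> R" if "i \<in> S" for i
    using that R(3) by (auto simp: U_def)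
  let ?E = "\<lambda>k l. \<Sum>i\<in>S. c i * u i powi k * v i powi l"
  have "?E k l \<in> R"
    using uv by (intro subring_sum[OF R(1)] subring_mult[OF R(1)] powi_R)
  then obtain I h where I: "ideal_of R I" "finite_index R I" "1 \<notin> I"
    and h: "h \<in> R" "?E k l * h - 1 \<in> I"
    using R(2) E unfolding finite_quotients_def by blast
  have "x \<in> R \<and> (\<exists>y\<in>R. x * y = 1)" if "x \<in> U" for x
    using UR U that by (intro conjI bexI[of _ "inverse x"]) auto
  then obtain N where N: "N > 0" "\<And>x. x \<in> U \<Longrightarrow> x ^ N - 1 \<in> I"
    using finite_units_common_order[OF R(1) I(1,2) finU] by metis
  have period: "x powi (int N * p) - 1 \<in> I" if x: "x \<in> U" for x p
  proof (cases "p \<ge> 0")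
    case True
    have "(x ^ N) ^ nat p - 1 \<in> I"
      using ideal_power_cong_one[OF R(1) I(1) subring_power[OF R(1) UR[OF x]] N(2)[OF x]] .
    moreover have "x powi (int N * p) = (x ^ N) ^ nat p"
      using True by (simp add: power_int_mult power_int_def[of _ p])
    ultimately show ?thesis by (simp only:)
  next
    case False
    note x' = U(2)[OF x]
    have "(inverse x ^ N) ^ nat (- p) - 1 \<in> I"
      using ideal_power_cong_one[OF R(1) I(1) subring_power[OF R(1) UR[OF x']] N(2)[OF x']] .
    moreover have "x powi (int N * p) = (inverse x ^ N) ^ nat (- p)"
      using False by (simp add: power_int_mult power_int_def[of _ p] power_inverse)
    ultimately show ?thesis by (simp only:)
  qed
  have "?E (k + int N * p) (l + int N * q) \<noteq> 0" for p q
  proof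
    assume z: "?E (k + int N * p) (l + int N * q) = 0"
    \<comment> \<open>Powers with exponents divisible by \<open>N\<close> are 1 modulo
      \<open>I\<close>, and \<open>A * B - 1 = A * (B - 1) + (A - 1)\<close>. So the two sums are
      congruent, while \<open>?E k l\<close> is a unit modulo \<open>I\<close>.\<close>
    have "?E (k + int N * p) (l + int N * q) - ?E k l
      = (\<Sum>i\<in>S. (c i * u i powi k * v i powi l) *
          (u i powi (int N * p) * (v i powi (int N * q) - 1) + (u i powi (int N * p) - 1)))"
      unfolding sum_subtractf[symmetric]
      by (intro sum.cong refl) (use nz in \<open>auto simp: power_int_add algebra_simps\<close>)
    also have "\<dots> \<in> I"
      using uv by (intro ideal_sum[OF R(1) I(1)] ideal_mult[OF R(1) I(1)] ideal_add[OF R(1) I(1)]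
        subring_mult[OF R(1)] powi_R period)
    finally have "- (?E k l) \<in> I" using z by simp
    then have "?E k l * h \<in> I"
      using ideal_mult'[OF R(1) I(1) _ h(1)] ideal_uminus[OF R(1) I(1)] by fastforce
    then have "?E k l * h - (?E k l * h - 1) \<in> I"
      using h(2) ideal_diff[OF R(1) I(1)] by blast
    then show False using I(3) by simp
  qed
  then show ?thesis using N(1) by blast
qed

text \<open>The sums \<open>\<Sum>\<^sub>i c\<^sub>i P(u\<^sub>i, v\<^sub>i)\<close> vanish for all polynomials \<open>P\<close>, in particular for a product of
  linear factors that vanishes at every point except the \<open>j\<close>-th; \<open>\<phi> i\<close> stands for \<open>P(u\<^sub>i, v\<^sub>i)\<close>.\<close>

lemma exponential_sum_zero_coeffs:
  fixes u v c :: "'i \<Rightarrow> 'a::field"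
  assumes S: "finite S" and inj: "inj_on (\<lambda>i. (u i, v i)) S"
    and E: "\<And>k l. (\<Sum>i\<in>S. c i * u i ^ k * v i ^ l) = 0" and j: "j \<in> S"
  shows "c j = 0"
proof -
  have *: "\<exists>\<phi>. \<phi> j \<noteq> 0 \<and> (\<forall>i\<in>B. \<phi> i = 0) \<and> (\<forall>k l. (\<Sum>i\<in>S. c i * \<phi> i * u i ^ k * v i ^ l) = 0)"
    if "finite B" "B \<subseteq> S - {j}" for B
    using that
  proof (induction B rule: finite_induct)
    case empty
    show ?case by (rule exI[of _ "\<lambda>_. 1"]) (simp add: E)
  next
    case (insert b B)
    then obtain \<phi> where \<phi>: "\<phi> j \<noteq> 0" "\<forall>i\<in>B. \<phi> i = 0"
      "\<And>k l. (\<Sum>i\<in>S. c i * \<phi> i * u i ^ k * v i ^ l) = 0" by auto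
    have "(u j, v j) \<noteq> (u b, v b)"
      using inj insert.prems j by (auto dest: inj_onD)
    then consider "u j \<noteq> u b" | "v j \<noteq> v b" by blast
    then show ?case
    proof cases
      case 1
      have "(\<Sum>i\<in>S. c i * (\<phi> i * (u i - u b)) * u i ^ k * v i ^ l) = 0" for k l
      proof -
        \<comment> \<open>A factor \<open>u i\<close> raises \<open>k\<close> by one, so vanishing
          for all exponents passes to the new weight.\<close>
        have "(\<Sum>i\<in>S. c i * (\<phi> i * (u i - u b)) * u i ^ k * v i ^ l)
          = (\<Sum>i\<in>S. c i * \<phi> i * u i ^ Suc k * v i ^ l) - u b * (\<Sum>i\<in>S. c i * \<phi> i * u i ^ k * v i ^ l)"
          unfolding sum_distrib_left sum_subtractf[symmetric]
          by (intro sum.cong refl) (simp add: algebra_simps)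
        then show ?thesis using \<phi>(3) by (simp only:) simp
      qed
      then show ?thesis
        using 1 \<phi> by (intro exI[of _ "\<lambda>i. \<phi> i * (u i - u b)"]) auto
    next
      case 2
      have "(\<Sum>i\<in>S. c i * (\<phi> i * (v i - v b)) * u i ^ k * v i ^ l) = 0" for k l
      proof -
        have "(\<Sum>i\<in>S. c i * (\<phi> i * (v i - v b)) * u i ^ k * v i ^ l)
          = (\<Sum>i\<in>S. c i * \<phi> i * u i ^ k * v i ^ Suc l) - v b * (\<Sum>i\<in>S. c i * \<phi> i * u i ^ k * v i ^ l)"
          unfolding sum_distrib_left sum_subtractf[symmetric]
          by (intro sum.cong refl) (simp add: algebra_simps)
        then show ?thesis using \<phi>(3) by (simp only:) simp
      qed
      then show ?thesis
        using 2 \<phi> by (intro exI[of _ "\<lambda>i. \<phi> i * (v i - v b)"]) auto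
    qed
  qed
  obtain \<phi> where \<phi>: "\<phi> j \<noteq> 0" "\<forall>i\<in>S - {j}. \<phi> i = 0"
    "\<And>k l. (\<Sum>i\<in>S. c i * \<phi> i * u i ^ k * v i ^ l) = 0"
    using *[OF finite_Diff[OF S] order_refl] by blast
  have "0 = (\<Sum>i\<in>S. c i * \<phi> i)" using \<phi>(3)[of 0 0] by simp
  also have "\<dots> = c j * \<phi> j" using \<phi>(2) S j by (subst sum.remove[of _ j]) auto
  finally show ?thesis using \<phi>(1) by simp
qed

section \<open>Trigonometric sums and the quadratic form of the kernel\<close>

definition trig_sum ::
    "'i set \<Rightarrow> ('i \<Rightarrow> real) \<Rightarrow> ('i \<Rightarrow> real) \<Rightarrow> ('i \<Rightarrow> real) \<Rightarrow> int \<Rightarrow> int \<Rightarrow> complex" where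
  "trig_sum S c \<theta> \<phi> k l =
     (\<Sum>i\<in>S. of_real (c i) * cis (of_int k * \<theta> i + of_int l * \<phi> i))"

lemma trig_sum_uminus: "trig_sum S c \<theta> \<phi> (- k) (- l) = cnj (trig_sum S c \<theta> \<phi> k l)"
  by (simp add: trig_sum_def cis_cnj add.commute)

lemma trig_sum_powi:
  "trig_sum S c \<theta> \<phi> k l = (\<Sum>i\<in>S. of_real (c i) * cis (\<theta> i) powi k * cis (\<phi> i) powi l)"
  unfolding trig_sum_def
  by (intro sum.cong refl) (simp add: cis_power_int cis_mult mult.assoc)

lemma norm_trig_sum:
  "(cmod (trig_sum S c \<theta> \<phi> k l))\<^sup>2 =
     (\<Sum>i\<in>S. \<Sum>j\<in>S. c i * c j * cos (of_int k * (\<theta> i - \<theta> j) + of_int l * (\<phi> i - \<phi> j)))"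
proof -
  let ?\<alpha> = "\<lambda>i. of_int k * \<theta> i + of_int l * \<phi> i"
  have "(cmod (trig_sum S c \<theta> \<phi> k l))\<^sup>2
      = (\<Sum>i\<in>S. c i * cos (?\<alpha> i)) * (\<Sum>j\<in>S. c j * cos (?\<alpha> j))
      + (\<Sum>i\<in>S. c i * sin (?\<alpha> i)) * (\<Sum>j\<in>S. c j * sin (?\<alpha> j))"
    unfolding cmod_power2 trig_sum_def by (simp add: power2_eq_square)
  also have "\<dots> = (\<Sum>i\<in>S. \<Sum>j\<in>S. c i * c j * cos (?\<alpha> i - ?\<alpha> j))"
    by (simp add: sum_product cos_diff algebra_simps flip: sum.distrib)
  finally show ?thesis by (simp add: algebra_simps)
qed

lemma has_sum_sum:
  fixes f :: "'i \<Rightarrow> 'b \<Rightarrow> 'c::topological_comm_monoid_add"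
  assumes "\<And>i. i \<in> S \<Longrightarrow> (f i has_sum g i) A"
  shows "((\<lambda>x. \<Sum>i\<in>S. f i x) has_sum (\<Sum>i\<in>S. g i)) A"
  using assms
  by (induction S rule: infinite_finite_induct) (auto intro: has_sum_add)

text \<open>The product of the cosines in \<open>k\<close> and \<open>l\<close> is the mean of the
  cosines of the sum and the difference of their arguments; each of these yields one squared modulus
  by \<open>norm_trig_sum\<close>.\<close>

lemma quadratic_form_has_sum:
  assumes cheb: "cheb_expansion Kr a"
  shows "((\<lambda>(k, l). a k l * (((cmod (trig_sum S c \<theta> \<phi> (int k) (int l)))\<^sup>2
      + (cmod (trig_sum S c \<theta> \<phi> (int k) (- int l)))\<^sup>2) / 2)) has_sum
    (\<Sum>i\<in>S. \<Sum>j\<in>S. c i * c j * Kr (cos (\<theta> i - \<theta> j)) (cos (\<phi> i - \<phi> j)))) UNIV"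
proof -
  have prod_to_sum: "C * D * (A * cos x * cos y)
      = A * ((C * D * cos (x + y) + C * D * cos (x - y)) / 2)" for A C D x y :: real
    by (simp add: cos_add cos_diff algebra_simps)
  have "((\<lambda>(k, l). a k l * cos (real k * t) * cos (real l * s)) has_sum Kr (cos t) (cos s)) UNIV" for t s
    using cheb unfolding cheb_expansion_def by (auto simp flip: poly_cheb_poly_cos)
  then have "((\<lambda>x. \<Sum>i\<in>S. \<Sum>j\<in>S. c i * c j * (case x of (k, l) \<Rightarrow>
        a k l * cos (real k * (\<theta> i - \<theta> j)) * cos (real l * (\<phi> i - \<phi> j)))) has_sum
      (\<Sum>i\<in>S. \<Sum>j\<in>S. c i * c j * Kr (cos (\<theta> i - \<theta> j)) (cos (\<phi> i - \<phi> j)))) UNIV"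
    by (intro has_sum_sum has_sum_cmult_right)
  moreover have "(\<Sum>i\<in>S. \<Sum>j\<in>S. c i * c j * (a k l * cos (real k * (\<theta> i - \<theta> j)) * cos (real l * (\<phi> i - \<phi> j))))
      = a k l * (((cmod (trig_sum S c \<theta> \<phi> (int k) (int l)))\<^sup>2
      + (cmod (trig_sum S c \<theta> \<phi> (int k) (- int l)))\<^sup>2) / 2)" for k l
    unfolding norm_trig_sum sum.distrib[symmetric] sum_distrib_left sum_divide_distrib
    by (intro sum.cong refl) (use prod_to_sum in simp)
  ultimately show ?thesis by (simp only: case_prod_unfold)
qed

text \<open>Nonnegative terms with sum zero all vanish. This settles the index pairs with first
  entry \<ge> 0; the others follow by complex conjugation.\<close>

lemma trig_sum_zero_if_form_zero:
  assumes cheb: "cheb_expansion Kr a"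
    and form: "(\<Sum>i\<in>S. \<Sum>j\<in>S. c i * c j * Kr (cos (\<theta> i - \<theta> j)) (cos (\<phi> i - \<phi> j))) = 0"
    and kl: "a (nat \<bar>k\<bar>) (nat \<bar>l\<bar>) > 0"
  shows "trig_sum S c \<theta> \<phi> k l = 0"
proof -
  let ?f = "\<lambda>(k, l). a k l * (((cmod (trig_sum S c \<theta> \<phi> (int k) (int l)))\<^sup>2
      + (cmod (trig_sum S c \<theta> \<phi> (int k) (- int l)))\<^sup>2) / 2)"
  have sum: "(?f has_sum 0) UNIV"
    using quadratic_form_has_sum[OF cheb, of S c \<theta> \<phi>] form by simp
  have a: "a k l \<ge> 0" for k l using cheb by (auto simp: cheb_expansion_def)
  have nonneg: "0 \<le> ?f x" for x using a by (auto split: prod.split)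
  have "\<not> 0 < ?f x" for x
  proof
    assume "0 < ?f x"
    from has_sum_strict_mono[OF has_sum_0_simp sum nonneg UNIV_I this] show False by simp
  qed
  then have "?f (nat \<bar>k\<bar>, nat \<bar>l\<bar>) = 0"
    using nonneg[of "(nat \<bar>k\<bar>, nat \<bar>l\<bar>)"] by (intro antisym) (simp_all only: not_less)
  then have "(cmod (trig_sum S c \<theta> \<phi> \<bar>k\<bar> \<bar>l\<bar>))\<^sup>2
      + (cmod (trig_sum S c \<theta> \<phi> \<bar>k\<bar> (- \<bar>l\<bar>)))\<^sup>2 = 0"
    using kl by simp
  then have z: "trig_sum S c \<theta> \<phi> \<bar>k\<bar> \<bar>l\<bar> = 0" "trig_sum S c \<theta> \<phi> \<bar>k\<bar> (- \<bar>l\<bar>) = 0"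
    unfolding sum_power2_eq_zero_iff by simp_all
  have "trig_sum S c \<theta> \<phi> (- \<bar>k\<bar>) (- \<bar>l\<bar>) = 0" "trig_sum S c \<theta> \<phi> (- \<bar>k\<bar>) \<bar>l\<bar> = 0"
    using trig_sum_uminus[of S c \<theta> \<phi> "\<bar>k\<bar>" "\<bar>l\<bar>"]
      trig_sum_uminus[of S c \<theta> \<phi> "\<bar>k\<bar>" "- \<bar>l\<bar>"]
    unfolding z minus_minus by simp_all
  with z show ?thesis
    by (cases "k \<ge> 0"; cases "l \<ge> 0") (simp_all add: abs_of_nonneg abs_of_neg)
qed

section \<open>Angular coordinates, finite point sets and roots of unity\<close>

definition circle_point :: "real \<Rightarrow> real ^ 2" where
  "circle_point \<theta> = vector [cos \<theta>, sin \<theta>]"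

lemma inner_circle_point: "circle_point \<theta> \<bullet> circle_point \<phi> = cos (\<theta> - \<phi>)"
  by (simp add: circle_point_def inner_vec_def sum_2 cos_diff)

lemma circle_point_in_circle: "circle_point \<theta> \<in> circle"
  by (simp add: norm_eq_sqrt_inner inner_circle_point)

lemma circle_point_eq_iff: "circle_point \<theta> = circle_point \<phi> \<longleftrightarrow> cis \<theta> = cis \<phi>"
  by (auto simp: circle_point_def vec_eq_iff forall_2 complex_eq_iff)

lemma circle_point_exhaust:
  assumes "x \<in> circle"
  obtains \<theta> where "x = circle_point \<theta>"
proof -
  have "(x $ 1)\<^sup>2 + (x $ 2)\<^sup>2 = 1"
    using assms by (simp add: norm_eq_sqrt_inner inner_vec_def sum_2 power2_eq_square)
  then obtain \<theta> where "x $ 1 = cos \<theta>" "x $ 2 = sin \<theta>"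
    using sincos_total_2pi by metis
  then have "x = circle_point \<theta>" by (simp add: circle_point_def vec_eq_iff forall_2)
  with that show thesis .
qed

text \<open>A bijection with \<open>{1..card S}\<close> transports the definition to arbitrary
  finite index sets, such as a grid of pairs.\<close>

lemma strictly_pos_def_finite_index_set:
  fixes x :: "'i \<Rightarrow> 'a"
  assumes K: "strictly_pos_def_kernel_on X K" and S: "finite S" "inj_on x S" "x ` S \<subseteq> X"
    and c: "i \<in> S" "c i \<noteq> 0"
  shows "(\<Sum>i\<in>S. \<Sum>j\<in>S. c i * c j * K (x i) (x j)) > 0"
proof -
  obtain h where h: "bij_betw h {1..card S} S"
    using ex_bij_betw_nat_finite_1[OF S(1)] by blast
  have "card S \<ge> 1" using c S by (metis One_nat_def Suc_leI card_gt_0_iff empty_iff)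
  moreover have "inj_on (x \<circ> h) {1..card S}"
    using h S(2) by (metis bij_betw_def comp_inj_on)
  moreover have "(x \<circ> h) ` {1..card S} \<subseteq> X"
    using h S(3) by (auto simp: bij_betw_def)
  moreover have "\<exists>\<mu>\<in>{1..card S}. (c \<circ> h) \<mu> \<noteq> 0"
    using h c unfolding bij_betw_def by (metis comp_apply imageE)
  ultimately have "(\<Sum>\<mu>=1..card S. \<Sum>\<nu>=1..card S.
      (c \<circ> h) \<mu> * (c \<circ> h) \<nu> * K ((x \<circ> h) \<mu>) ((x \<circ> h) \<nu>)) > 0"
    using K unfolding strictly_pos_def_kernel_on_def by blast
  also have "(\<Sum>\<mu>=1..card S. \<Sum>\<nu>=1..card S.
      (c \<circ> h) \<mu> * (c \<circ> h) \<nu> * K ((x \<circ> h) \<mu>) ((x \<circ> h) \<nu>))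
    = (\<Sum>\<mu>=1..card S. \<Sum>j\<in>S. c (h \<mu>) * c j * K (x (h \<mu>)) (x j))"
    by (intro sum.cong refl, subst sum.reindex_bij_betw[OF h, symmetric]) simp
  also have "\<dots> = (\<Sum>i\<in>S. \<Sum>j\<in>S. c i * c j * K (x i) (x j))"
    by (subst sum.reindex_bij_betw[OF h, symmetric]) simp
  finally show ?thesis .
qed

text \<open>A geometric sum whose ratio is an \<open>N\<close>-th root of unity other than
  1.\<close>

lemma sum_roots_of_unity:
  assumes N: "N > 0" and m: "\<not> int N dvd m"
  shows "(\<Sum>u<N. cis (of_int m * (2 * pi * real u / real N))) = 0"
proof -
  let ?z = "cis (of_int m * (2 * pi / real N))"
  have "?z \<noteq> 1"
  proof
    assume "?z = 1"
    then have "cos (of_int m * (2 * pi / real N)) = 1" by (simp add: complex_eq_iff)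
    then obtain n :: int where "of_int m * (2 * pi / real N) = of_int n * 2 * pi"
      using cos_one_2pi_int by blast
    then have "(of_int m :: real) = of_int (n * int N)"
      using N by (simp add: field_simps)
    then have "m = n * int N" by (simp only: of_int_eq_iff)
    then show False using m by simp
  qed
  moreover have "?z ^ N = 1"
  proof -
    have "?z ^ N = cis (of_int m * (2 * pi))" using N by (simp add: Complex.DeMoivre)
    also have "\<dots> = 1" using cis_multiple_2pi[of "of_int m"] by (simp add: mult.commute)
    finally show ?thesis .
  qed
  moreover have "(\<Sum>u<N. cis (of_int m * (2 * pi * real u / real N))) = (\<Sum>u<N. ?z ^ u)"
    by (intro sum.cong refl) (simp add: Complex.DeMoivre mult_ac)
  ultimately show ?thesis by (simp add: geometric_sum)
qed

lemma kernel_circle_point: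
  assumes "isotropic_part K Kr"
  shows "K (circle_point \<theta>, circle_point \<phi>) (circle_point \<theta>', circle_point \<phi>')
    = Kr (cos (\<theta> - \<theta>')) (cos (\<phi> - \<phi>'))"
  using assms circle_point_in_circle unfolding isotropic_part_def inner_circle_point[symmetric]
  by blast

section \<open>Sufficiency of the lattice condition\<close>

lemma strictly_pos_def_if_meets_lattice_translations:
  assumes iso: "isotropic_part K Kr" and pd: "pos_def_kernel_on (circle \<times> circle) K"
    and cheb: "cheb_expansion Kr a"
    and meets: "\<forall>L T. is_lattice_Z2 L \<and> is_translation_of T L \<longrightarrow>
       {(k :: int, l :: int). a (nat \<bar>k\<bar>) (nat \<bar>l\<bar>) > 0} \<inter> T \<noteq> {}"
  shows "strictly_pos_def_kernel_on (circle \<times> circle) K"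
  unfolding strictly_pos_def_kernel_on_def
proof (intro conjI allI impI pd, elim conjE)
  fix n :: nat and x :: "nat \<Rightarrow> (real ^ 2) \<times> (real ^ 2)" and c :: "nat \<Rightarrow> real"
  let ?S = "{1..n}"
  assume n: "n \<ge> 1" and inj: "inj_on x ?S" and sub: "x ` ?S \<subseteq> circle \<times> circle"
    and c: "\<exists>\<mu>\<in>?S. c \<mu> \<noteq> 0"
  have "\<forall>\<mu>. \<exists>\<theta> \<phi>. \<mu> \<in> ?S \<longrightarrow> x \<mu> = (circle_point \<theta>, circle_point \<phi>)"
  proof
    fix \<mu>
    have "fst (x \<mu>) \<in> circle \<and> snd (x \<mu>) \<in> circle" if "\<mu> \<in> ?S"
      using sub that by (metis image_subset_iff mem_Times_iff)
    then show "\<exists>\<theta> \<phi>. \<mu> \<in> ?S \<longrightarrow> x \<mu> = (circle_point \<theta>, circle_point \<phi>)"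
      by (metis circle_point_exhaust prod.collapse)
  qed
  then obtain \<theta> \<phi> where x: "\<And>\<mu>. \<mu> \<in> ?S \<Longrightarrow> x \<mu> = (circle_point (\<theta> \<mu>), circle_point (\<phi> \<mu>))"
    by metis
  let ?Q = "\<Sum>\<mu>=1..n. \<Sum>\<nu>=1..n. c \<mu> * c \<nu> * K (x \<mu>) (x \<nu>)"
  have Q: "?Q = (\<Sum>\<mu>\<in>?S. \<Sum>\<nu>\<in>?S. c \<mu> * c \<nu> * Kr (cos (\<theta> \<mu> - \<theta> \<nu>)) (cos (\<phi> \<mu> - \<phi> \<nu>)))"
    by (intro sum.cong refl) (simp only: x kernel_circle_point[OF iso])
  have "?Q \<ge> 0" using pd n inj sub unfolding pos_def_kernel_on_def by blast
  moreover have "?Q \<noteq> 0"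
  proof
    assume "?Q = 0"
    note zero = trig_sum_zero_if_form_zero[OF cheb, OF Q[symmetric, unfolded this]]
    have inj': "inj_on (\<lambda>\<mu>. (cis (\<theta> \<mu>), cis (\<phi> \<mu>))) ?S"
    proof (rule inj_onI)
      fix \<mu> \<nu> assume *: "\<mu> \<in> ?S" "\<nu> \<in> ?S" "(cis (\<theta> \<mu>), cis (\<phi> \<mu>)) = (cis (\<theta> \<nu>), cis (\<phi> \<nu>))"
      then have "x \<mu> = x \<nu>" by (simp only: x prod.inject circle_point_eq_iff)
      then show "\<mu> = \<nu>" using inj * by (meson inj_onD)
    qed
    \<comment> \<open>Distinct points give linearly independent exponentials, already on nonnegative
      exponents, and \<open>c\<close> is not zero.\<close>
    obtain k l where kl: "trig_sum ?S c \<theta> \<phi> (int k) (int l) \<noteq> 0"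
    proof (rule ccontr)
      assume "\<not> thesis"
      then have "trig_sum ?S c \<theta> \<phi> (int k) (int l) = 0" for k l using that by blast
      then have vanish: "(\<Sum>\<mu>\<in>?S. of_real (c \<mu>) * cis (\<theta> \<mu>) ^ k * cis (\<phi> \<mu>) ^ l) = 0" for k l
        unfolding trig_sum_powi power_int_of_nat .
      have "complex_of_real (c \<mu>) = 0" if "\<mu> \<in> ?S" for \<mu>
        using exponential_sum_zero_coeffs[where c = "\<lambda>\<mu>. complex_of_real (c \<mu>)",
            OF finite_atLeastAtMost inj' vanish that] .
      then show False using c by simp
    qed
    have "cis (\<theta> \<mu>) \<noteq> 0 \<and> cis (\<phi> \<mu>) \<noteq> 0" for \<mu> by simp
    from exponential_sum_nonvanishing_coset[OF finite_atLeastAtMost this kl[unfolded trig_sum_powi]]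
    obtain N where N: "N > 0"
      "\<And>p q. trig_sum ?S c \<theta> \<phi> (int k + int N * p) (int l + int N * q) \<noteq> 0"
      unfolding trig_sum_powi by blast
    \<comment> \<open>The lattice of pairs of multiples of \<open>N\<close>; the summand
      \<open>p * 0\<close> keeps the shape of the definition with \<open>b = 0\<close>.\<close>
    let ?L = "{(p * int N, p * 0 + q * int N) |p q. True}"
    let ?T = "{(int k + i, int l + j) |i j. (i, j) \<in> ?L}"
    have "is_lattice_Z2 ?L" using N(1) unfolding is_lattice_Z2_def
      by (intro exI[of _ "int N"] exI[of _ 0]) auto
    moreover have "is_translation_of ?T ?L" unfolding is_translation_of_def by blast
    ultimately have "{(k, l). a (nat \<bar>k\<bar>) (nat \<bar>l\<bar>) > 0} \<inter> ?T \<noteq> {}" using meets by blast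
    then obtain p q where
      "a (nat \<bar>int k + p * int N\<bar>) (nat \<bar>int l + (p * 0 + q * int N)\<bar>) > 0" by blast
    from zero[OF this] show False using N(2)[of p q] by (simp add: mult.commute)
  qed
  ultimately show "?Q > 0" by linarith
qed

section \<open>Necessity of the lattice condition\<close>

lemma meets_lattice_translation_if_strictly_pos_def:
  assumes iso: "isotropic_part K Kr" and cheb: "cheb_expansion Kr a"
    and spd: "strictly_pos_def_kernel_on (circle \<times> circle) K"
    and L: "is_lattice_Z2 L" and T: "is_translation_of T L"
  shows "{(k :: int, l :: int). a (nat \<bar>k\<bar>) (nat \<bar>l\<bar>) > 0} \<inter> T \<noteq> {}"
proof
  assume disj: "{(k :: int, l :: int). a (nat \<bar>k\<bar>) (nat \<bar>l\<bar>) > 0} \<inter> T = {}"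
  obtain \<alpha> \<beta> \<delta> where L': "\<alpha> > 0" "\<delta> > 0" "L = {(p * \<alpha>, p * \<beta> + q * \<delta>) |p q. True}"
    using L unfolding is_lattice_Z2_def by blast
  obtain j j' where T': "T = {(j + m, j' + n) |m n. (m, n) \<in> L}"
    using T unfolding is_translation_of_def by blast
  \<comment> \<open>\<open>L\<close> contains all pairs of multiples of \<alpha>\<delta>, so a coset
    of this square lattice lies in \<open>T\<close>.\<close>
  define N where "N = nat (\<alpha> * \<delta>)"
  have N: "N > 0" "int N = \<alpha> * \<delta>" using L'(1,2) by (simp_all add: N_def)
  have in_T: "(k, l) \<in> T" if kl: "int N dvd k - j" "int N dvd l - j'" for k l
  proof -
    obtain x y where xy: "k - j = int N * x" "l - j' = int N * y" using kl unfolding dvd_def by blast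
    have "k - j = (\<delta> * x) * \<alpha> \<and> l - j' = (\<delta> * x) * \<beta> + (\<alpha> * y - x * \<beta>) * \<delta>"
      unfolding xy N(2) by (simp add: algebra_simps)
    then have "(k - j, l - j') \<in> L" unfolding L'(3) by blast
    moreover have "(k, l) = (j + (k - j), j' + (l - j'))" by simp
    ultimately show ?thesis unfolding T' by blast
  qed
  define S where "S = {..<N} \<times> {..<N}"
  define \<omega> where "\<omega> u = 2 * pi * real u / real N" for u
  define \<theta> where "\<theta> x = \<omega> (fst x)" for x :: "nat \<times> nat"
  define \<phi> where "\<phi> x = \<omega> (snd x)" for x :: "nat \<times> nat"
  \<comment> \<open>Half the sum of the characters of frequencies \<open>(j, j')\<close> and
    \<open>(-j, -j')\<close>: real weights on the grid of \<open>N\<close>-th roots of unity whose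
    Fourier transform lives on two cosets.\<close>
  define c where "c x = cos (of_int j * \<theta> x + of_int j' * \<phi> x)" for x
  let ?x = "\<lambda>i. (circle_point (\<theta> i), circle_point (\<phi> i))"
  have inj_\<omega>: "u = v" if uv: "u < N" "v < N" "cis (\<omega> u) = cis (\<omega> v)" for u v
  proof (rule ccontr)
    assume "u \<noteq> v"
    have "cis (\<omega> u - \<omega> v) = 1" using uv(3) by (simp flip: cis_divide)
    then have "cos (\<omega> u - \<omega> v) = 1" by (simp add: complex_eq_iff)
    then obtain n :: int where "\<omega> u - \<omega> v = of_int n * 2 * pi" using cos_one_2pi_int by blast
    then have "2 * pi * (real u - real v) = 2 * pi * (of_int n * real N)"
      using N(1) by (simp add: \<omega>_def field_simps)
    then have "(of_int (int u - int v) :: real) = of_int (n * int N)" by simp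
    then have "int u - int v = n * int N" by (simp only: of_int_eq_iff)
    then have "int N dvd int u - int v" by simp
    then have "int N \<le> \<bar>int u - int v\<bar>"
      using \<open>u \<noteq> v\<close> by (intro zdvd_imp_le) auto
    then show False using uv(1,2) by linarith
  qed
  have inj: "inj_on ?x S"
    by (rule inj_onI) (auto simp: S_def \<theta>_def \<phi>_def circle_point_eq_iff intro: inj_\<omega>)
  have sub: "?x ` S \<subseteq> circle \<times> circle" using circle_point_in_circle by blast
  have S: "finite S" "(0, 0) \<in> S" using N(1) by (auto simp: S_def)
  have "c (0, 0) \<noteq> 0" by (simp add: c_def \<theta>_def \<phi>_def \<omega>_def)
  note pos = strictly_pos_def_finite_index_set[OF spd S(1) inj sub S(2), of c, OF this]

  let ?G = "\<lambda>m. \<Sum>u<N. cis (of_int m * \<omega> u)"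
  \<comment> \<open>Each character splits into its two coordinates, so the grid sum factors into
    sums over \<open>N\<close>-th roots of unity.\<close>
  have trig: "trig_sum S c \<theta> \<phi> k l = (?G (k + j) * ?G (l + j') + ?G (k - j) * ?G (l - j')) / 2" for k l
  proof -
    have prod: "of_real (cos t) * cis s = (cis (s + t) + cis (s - t)) / 2" for s t
      by (simp add: complex_eq_iff cos_add cos_diff sin_add sin_diff)
    have "trig_sum S c \<theta> \<phi> k l = (\<Sum>x\<in>S.
        (cis (of_int (k + j) * \<omega> (fst x)) * cis (of_int (l + j') * \<omega> (snd x))
        + cis (of_int (k - j) * \<omega> (fst x)) * cis (of_int (l - j') * \<omega> (snd x))) / 2)"
      unfolding trig_sum_def c_def \<theta>_def \<phi>_def prod cis_mult
      by (intro sum.cong refl) (simp add: algebra_simps)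
    also have "\<dots> = (?G (k + j) * ?G (l + j') + ?G (k - j) * ?G (l - j')) / 2"
      unfolding S_def sum_product sum.cartesian_product sum_divide_distrib[symmetric] sum.distrib
      by (simp add: case_prod_unfold)
    finally show ?thesis .
  qed
  have G: "?G m = 0" if "\<not> int N dvd m" for m
    using sum_roots_of_unity[OF N(1) that] by (simp add: \<omega>_def)
  have zero: "trig_sum S c \<theta> \<phi> k l = 0" if kl: "a (nat \<bar>k\<bar>) (nat \<bar>l\<bar>) > 0" for k l
  proof -
    \<comment> \<open>The index set is symmetric under negation, so it avoids the opposite coset
      too.\<close>
    have "(x, y) \<notin> T" if "a (nat \<bar>x\<bar>) (nat \<bar>y\<bar>) > 0" for x y using disj that by blast
    from this[of k l] this[of "- k" "- l"] have "(k, l) \<notin> T" "(- k, - l) \<notin> T"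
      using kl by simp_all
    then have "\<not> (int N dvd k - j \<and> int N dvd l - j')" "\<not> (int N dvd k + j \<and> int N dvd l + j')"
      using in_T[of k l] in_T[of "- k" "- l"] dvd_minus_iff[of "int N" "k + j"]
        dvd_minus_iff[of "int N" "l + j'"] by auto
    then have "?G (k - j) * ?G (l - j') = 0" "?G (k + j) * ?G (l + j') = 0"
      using G by (metis mult_eq_0_iff)+
    then show ?thesis unfolding trig by (simp only: add_0 div_0)
  qed
  have "a k l * (((cmod (trig_sum S c \<theta> \<phi> (int k) (int l)))\<^sup>2
      + (cmod (trig_sum S c \<theta> \<phi> (int k) (- int l)))\<^sup>2) / 2) = 0" for k l
  proof (cases "a k l > 0")
    case True
    then show ?thesis using zero[of "int k" "int l"] zero[of "int k" "- int l"] by simp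
  next
    case False
    moreover have "a k l \<ge> 0" using cheb by (simp add: cheb_expansion_def)
    ultimately show ?thesis by simp
  qed
  then have "((\<lambda>(k :: nat, l :: nat). 0 :: real) has_sum
      (\<Sum>i\<in>S. \<Sum>j\<in>S. c i * c j * Kr (cos (\<theta> i - \<theta> j)) (cos (\<phi> i - \<phi> j)))) UNIV"
    using quadratic_form_has_sum[OF cheb, of S c \<theta> \<phi>] by (simp only:)
  then have "(\<Sum>i\<in>S. \<Sum>j\<in>S. c i * c j * Kr (cos (\<theta> i - \<theta> j)) (cos (\<phi> i - \<phi> j))) = 0"
    using has_sum_unique[OF _ has_sum_0_simp] by (simp add: case_prod_unfold)
  then show False using pos by (simp only: kernel_circle_point[OF iso])
qed

theorem theorem1p1:
  fixes K :: "(real ^ 2) \<times> (real ^ 2) \<Rightarrow> (real ^ 2) \<times> (real ^ 2) \<Rightarrow> real"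
    and K\<^sub>r :: "real \<Rightarrow> real \<Rightarrow> real"
    and a :: "nat \<Rightarrow> nat \<Rightarrow> real"
  assumes "continuous_torus_kernel K"
    and "isotropic_part K K\<^sub>r"
    and "pos_def_kernel_on (circle \<times> circle) K"
    and "cheb_expansion K\<^sub>r a"
  shows "strictly_pos_def_kernel_on (circle \<times> circle) K \<longleftrightarrow>
    (\<forall>L T. is_lattice_Z2 L \<and> is_translation_of T L \<longrightarrow>
       {(k :: int, l :: int). a (nat \<bar>k\<bar>) (nat \<bar>l\<bar>) > 0} \<inter> T \<noteq> {})"
  using strictly_pos_def_if_meets_lattice_translations[OF assms(2-4)]
    meets_lattice_translation_if_strictly_pos_def[OF assms(2,4)] by blast

end
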